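(* Assume that $C(t)$, $A(t)$, $B(t)$ and $Q_o(t)$ exist and are bounded on $[t_0,t_f]$, and let $N_s=\ker\left(\mathrm{diag}\left(\begin{bmatrix}\bar c\\ \mathbf{0}_{n\times1}\end{bmatrix}\right)\right)$, where $\bar c\in\mathbb{R}^k$ has nonzero entries exactly at the positions of the known parameters of $c$. If there is an interval $[t_0,T]$ with $0<T\leq t_f$ on which $Q_p=N_s^TQ_o(t)Q_o(t)^TN_s$ is full rank almost everywhere, then $N_s^TP(0)N_s$ is positive definite and a unique solution to the (soft-constrained) IOC problem exists.
   Context: Primary optimal control problem: minimize $\int_{t_0}^{t_f} c^T\phi(t,x(t),u(t))\,dt$ subject to $\dot x=f(t,x,u)$, $x(0)=x_0$, $x\in\mathbb{R}^n$, $u\in\mathbb{R}^m$, known basis $\phi\in\mathbb{R}^k_+$, unknown weights $c\in\mathbb{R}^k$ (some entries known), $f$ continuously differentiable. Soft-constrained IOC: with $z=[c^T\ p^T]^T\in\mathbb{R}^{k+n}$, $p$ the costate, one minimizes $z_0^TP(0)z_0$ where $P(t)$ solves $\dot P=-A^TP-PA-C^TC+PBR^{-1}B^TP$, $P(t_f)=\mathbf{0}$, with $A(t)=-\begin{bmatrix}\mathbf{0}&\mathbf{0}\\ \nabla_x\phi^T&\nabla_xf^T\end{bmatrix}$, $B=\begin{bmatrix}\mathbf{0}_{k\times n}\\ I_n\end{bmatrix}$, $R=I$, $C(t)=\begin{bmatrix}\nabla_u\phi^T&\nabla_uf^T\end{bmatrix}$ (all evaluated along the observed trajectory). The time-varying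 observability matrix of order $l=k+n$ is $Q_o(t)=\begin{bmatrix}C^T & \Delta_oC^T & \cdots & \Delta_o^{l-1}C^T\end{bmatrix}$ with $\Delta_o=A^T(t)+\frac{d}{dt}$. It is sufficient for unique solvability that $N_s^TP(0)N_s$ be full rank. *)

theory Defs
  imports "HOL-Analysis.Analysis" "HOL-Library.Countable_Set"
begin

text \<open>State vector z = [c; p] indexed by the sum type 'k + 'n
  (first k entries: cost weights c, last n entries: costate p).\<close>

definition Amat :: "(real \<Rightarrow> real^'n^'k) \<Rightarrow> (real \<Rightarrow> real^'n^'n) \<Rightarrow> real \<Rightarrow> real^('k + 'n)^('k + 'n)"
  where "Amat Jxphi Jxf t = (\<chi> r s. case r of
            Inl _ \<Rightarrow> 0
          | Inr a \<Rightarrow> (case s of Inl b \<Rightarrow> - (Jxphi t $ b $ a) | Inr b \<Rightarrow> - (Jxf t $ b $ a)))"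

definition Cmat :: "(real \<Rightarrow> real^'m^'k) \<Rightarrow> (real \<Rightarrow> real^'m^'n) \<Rightarrow> real \<Rightarrow> real^('k + 'n)^'m"
  where "Cmat Juphi Juf t = (\<chi> i s. case s of Inl b \<Rightarrow> Juphi t $ b $ i | Inr b \<Rightarrow> Juf t $ b $ i)"

definition Bmat :: "real^'n::finite^('k::finite + 'n)"
  where "Bmat = (\<chi> r a. case r of Inl _ \<Rightarrow> 0 | Inr a' \<Rightarrow> (if a' = a then 1 else 0))"

text \<open>Blocks of the observability matrix: obs_blk j = Delta_o^j C^T with
  Delta_o M = A^T M + dM/dt (derivative taken within the time interval S).\<close>

fun obs_blk :: "(real \<Rightarrow> real^'l^'l) \<Rightarrow> (real \<Rightarrow> real^'l^'m) \<Rightarrow> real set \<Rightarrow> nat \<Rightarrow> real \<Rightarrow> real^'m^'l"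
  where
    "obs_blk A C S 0 = (\<lambda>t. transpose (C t))"
  | "obs_blk A C S (Suc j) = (\<lambda>t. transpose (A t) ** obs_blk A C S j t
                                   + vector_derivative (obs_blk A C S j) (at t within S))"

text \<open>Observability matrix of order l = CARD('l):
  Q_o = [C^T, Delta_o C^T, ..., Delta_o^(l-1) C^T]; column (j,i) is column i of block number j,
  where the block index j :: 'l is enumerated as 0..l-1 by a fixed bijection.\<close>

definition obs_mat :: "(real \<Rightarrow> real^'l::finite^'l) \<Rightarrow> (real \<Rightarrow> real^'l^'m::finite) \<Rightarrow> real set \<Rightarrow> real \<Rightarrow> real^('l \<times> 'm)^'l"
  where "obs_mat A C S t = (\<chi> r jc. obs_blk A C S (to_nat_on (UNIV :: 'l set) (fst jc)) t $ r $ snd jc)"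

definition diag_mat :: "real^'a \<Rightarrow> real^'a^'a"
  where "diag_mat v = (\<chi> i j. if i = j then v $ i else 0)"

text \<open>[cbar; 0_{n x 1}]\<close>
definition ext_zero :: "real^'k::finite \<Rightarrow> real^('k + 'n::finite)"
  where "ext_zero cb = (\<chi> r. case r of Inl i \<Rightarrow> cb $ i | Inr _ \<Rightarrow> 0)"

definition pos_def_mat :: "real^'a^'a \<Rightarrow> bool"
  where "pos_def_mat M \<longleftrightarrow> transpose M = M \<and> (\<forall>x. x \<noteq> 0 \<longrightarrow> 0 < x \<bullet> (M *v x))"

text \<open>Feasible points of the soft-constrained IOC problem: z0 = [c; p(0)] whose
  known weight entries (positions where cbar is nonzero) equal the known values cbar.\<close>
definition ioc_feasible :: "real^'k::finite \<Rightarrow> real^('k + 'n::finite) \<Rightarrow> bool"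
  where "ioc_feasible cb z \<longleftrightarrow> (\<forall>i. cb $ i \<noteq> 0 \<longrightarrow> z $ Inl i = cb $ i)"

end

theory Submission
  imports Defs
begin

text \<open>
  Everything rests on positivity of the quadratic form of \<open>P(0)\<close> on the range of \<open>N\<^sub>s\<close>, which is a
  Lyapunov argument. The solution \<open>P\<close> of the Riccati equation is symmetric, because \<open>P\<close> and
  \<open>P\<^sup>T\<close> solve the same equation with the same terminal value. Suppose \<open>z\<^sub>0 = N\<^sub>s w\<close> and
  \<open>z\<^sub>0\<^sup>T P(0) z\<^sub>0 \<le> 0\<close>, and let \<open>x\<close> solve the closed-loop equation \<open>x' = (A - B B\<^sup>T P) x\<close>,
  \<open>x(0) = z\<^sub>0\<close>. Then \<open>V = x\<^sup>T P x\<close> satisfies \<open>V' = - (|C x|\<^sup>2 + |B\<^sup>T P x|\<^sup>2) \<le> 0\<close> and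
  \<open>V(t\<^sub>f) = 0\<close>, so \<open>V\<close> vanishes identically: \<open>C x = 0\<close>, \<open>B\<^sup>T P x = 0\<close>, and \<open>x\<close> is an
  unobservable solution of \<open>x' = A x\<close>. Differentiating \<open>x\<^sup>T \<Delta>\<^sub>o\<^sup>j C\<^sup>T = 0\<close> gives
  \<open>x\<^sup>T Q\<^sub>o = 0\<close>. The rows of \<open>A\<close> belonging to the weights \<open>c\<close> vanish, so \<open>x\<close> keeps the
  known entries of \<open>z\<^sub>0\<close> and stays in the range of \<open>N\<^sub>s\<close>; at a time in \<open>[0, T]\<close> where
  \<open>Q\<^sub>p\<close> has full rank this forces \<open>x = 0\<close>, and uniqueness for the linear equation gives
  \<open>z\<^sub>0 = 0\<close>. Finally the cost is the quadratic form of \<open>P(0)\<close> on the affine set of feasible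
  points, whose direction space is the range of \<open>N\<^sub>s\<close>, so it has a unique minimiser.
\<close>

lemma bounded_bilinear_matrix_vector_mult [bounded_bilinear]:
  "bounded_bilinear ((*v) :: real^'n^'m \<Rightarrow> real^'n \<Rightarrow> real^'m)"
  unfolding bilinear_conv_bounded_bilinear[symmetric] bilinear_def
  by (auto intro!: linearI simp: algebra_simps vec_eq_iff matrix_vector_mult_def sum.distrib
      sum_distrib_left)

lemma bounded_bilinear_matrix_matrix_mult [bounded_bilinear]:
  "bounded_bilinear ((**) :: real^'n^'m \<Rightarrow> real^'p^'n \<Rightarrow> real^'p^'m)"
  unfolding bilinear_conv_bounded_bilinear[symmetric] bilinear_def
  by (auto intro!: linearI
      simp: vec_eq_iff matrix_matrix_mult_def sum_distrib_left sum.distrib algebra_simps)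

lemma bounded_bilinear_vector_matrix_mult [bounded_bilinear]:
  "bounded_bilinear ((v*) :: real^'m \<Rightarrow> real^'n^'m \<Rightarrow> real^'n)"
  unfolding bilinear_conv_bounded_bilinear[symmetric] bilinear_def
  by (auto intro!: linearI
      simp: vec_eq_iff vector_matrix_mult_def sum_distrib_left sum.distrib algebra_simps)

lemma bounded_linear_transpose [bounded_linear]:
  "bounded_linear (transpose :: real^'n^'m \<Rightarrow> real^'m^'n)"
  unfolding linear_conv_bounded_linear[symmetric]
  by (auto intro!: linearI simp: vec_eq_iff transpose_def)

lemma transpose_add: "transpose (X + Y) = transpose X + transpose (Y :: real^'n^'m)"
  by (simp add: vec_eq_iff transpose_def)

lemma transpose_diff: "transpose (X - Y) = transpose X - transpose (Y :: real^'n^'m)"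
  by (simp add: vec_eq_iff transpose_def)

lemma transpose_zero: "transpose (0 :: real^'n^'m) = 0"
  by (simp add: vec_eq_iff transpose_def)

lemma transpose_uminus: "transpose (- X) = - transpose (X :: real^'n^'m)"
  by (simp add: vec_eq_iff transpose_def)

lemmas matrix_mult_distribs =
  bounded_bilinear.add_left[OF bounded_bilinear_matrix_matrix_mult]
  bounded_bilinear.add_right[OF bounded_bilinear_matrix_matrix_mult]
  bounded_bilinear.diff_left[OF bounded_bilinear_matrix_matrix_mult]
  bounded_bilinear.diff_right[OF bounded_bilinear_matrix_matrix_mult]
  bounded_bilinear.minus_left[OF bounded_bilinear_matrix_matrix_mult]
  bounded_bilinear.minus_right[OF bounded_bilinear_matrix_matrix_mult]

lemma inner_matrix_vector_transpose: "u \<bullet> (X *v w) = (transpose X *v u) \<bullet> w"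
  for X :: "real^'n^'m"
  by (simp add: dot_lmul_matrix)

lemma inner_matrix_vector_symmetric:
  fixes Q :: "real^'l^'l"
  assumes "transpose Q = Q"
  shows "u \<bullet> (Q *v w) = w \<bullet> (Q *v u)"
  by (metis assms inner_commute inner_matrix_vector_transpose)

lemma bounded_bilinear_compact_bound:
  fixes prod :: "'a::real_normed_vector \<Rightarrow> 'b::real_normed_vector \<Rightarrow> 'c::real_normed_vector"
    and X :: "'s::metric_space \<Rightarrow> 'a"
  assumes "bounded_bilinear prod" "compact S" "continuous_on S X"
  obtains K where "0 \<le> K" "\<And>t v. t \<in> S \<Longrightarrow> norm (prod (X t) v) \<le> K * norm v"
proof -
  obtain KP where KP: "\<And>x y. norm (prod x y) \<le> norm x * norm y * KP" "0 < KP"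
    using bounded_bilinear.pos_bounded[OF assms(1)] by blast
  obtain KX where KX: "0 \<le> KX" "\<And>t. t \<in> S \<Longrightarrow> norm (X t) \<le> KX"
    using compact_imp_bounded[OF compact_continuous_image[OF assms(3,2)]]
    unfolding bounded_iff by (metis image_eqI norm_ge_zero order_trans)
  show thesis
  proof
    fix t v assume "t \<in> S"
    have "norm (prod (X t) v) \<le> norm (X t) * norm v * KP" by (rule KP)
    also have "\<dots> \<le> KX * norm v * KP"
      using KX(2)[OF \<open>t \<in> S\<close>] KP(2) by (intro mult_right_mono) auto
    finally show "norm (prod (X t) v) \<le> (KX * KP) * norm v" by (simp add: algebra_simps)
  qed (use KX KP in simp)
qed

lemma has_vector_derivative_imp_continuous_on:
  assumes "\<And>t. t \<in> S \<Longrightarrow> (f has_vector_derivative f' t) (at t within S)"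
  shows "continuous_on S f"
  unfolding continuous_on_eq_continuous_within
  using assms has_vector_derivative_continuous by blast

lemma has_real_derivative_nonpos_imp_antitone:
  fixes h :: "real \<Rightarrow> real"
  assumes der: "\<And>s. s \<in> {a..b} \<Longrightarrow> (h has_real_derivative h' s) (at s within {a..b})"
    and nonpos: "\<And>s. s \<in> {a..b} \<Longrightarrow> h' s \<le> 0"
    and "a \<le> x" "x \<le> y" "y \<le> b"
  shows "h y \<le> h x"
proof -
  have "\<exists>s\<in>{x..y}. h y - h x = h' s * (y - x)"
  proof (rule mvt_very_simple[OF \<open>x \<le> y\<close>, of h "\<lambda>s d. h' s * d"])
    fix s assume "x \<le> s" "s \<le> y"
    with assms have "(h has_real_derivative h' s) (at s within {x..y})"
      by (intro DERIV_subset[OF der]) auto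
    then show "(h has_derivative (\<lambda>d. h' s * d)) (at s within {x..y})"
      by (simp add: has_field_derivative_def)
  qed
  then obtain s where "s \<in> {x..y}" "h y - h x = h' s * (y - x)" by blast
  moreover have "h' s * (y - x) \<le> 0"
    using nonpos[of s] \<open>s \<in> {x..y}\<close> assms by (intro mult_nonpos_nonneg) auto
  ultimately show ?thesis by linarith
qed

lemma has_real_derivative_nonpos_imp_zero:
  fixes h :: "real \<Rightarrow> real"
  assumes ab: "a < b"
    and der: "\<And>s. s \<in> {a..b} \<Longrightarrow> (h has_real_derivative h' s) (at s within {a..b})"
    and nonpos: "\<And>s. s \<in> {a..b} \<Longrightarrow> h' s \<le> 0"
    and ends: "h a \<le> h b" and t: "t \<in> {a..b}"
  shows "h' t = 0"
proof -
  have const: "h s = h a" if "s \<in> cbox a b" for s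
  proof -
    have "h s \<le> h a" "h b \<le> h s"
      by (rule has_real_derivative_nonpos_imp_antitone[OF der nonpos];
          use that in \<open>auto simp: cbox_interval\<close>)+
    with ends show ?thesis by linarith
  qed
  have t_cbox: "t \<in> cbox a b" using t by (simp add: cbox_interval)
  have zero: "(h has_vector_derivative 0) (at t within cbox a b)"
    by (rule has_vector_derivative_transform[OF t_cbox const has_vector_derivative_const])
  have "(h has_vector_derivative h' t) (at t within cbox a b)"
    using der[OF t] by (simp add: cbox_interval has_real_derivative_iff_has_vector_derivative)
  from vector_derivative_unique_within_closed_interval[OF ab t_cbox this zero]
  show ?thesis .
qed

lemma exp_weighted_inner_self_has_derivative:
  fixes f :: "real \<Rightarrow> 'a::real_inner"
  assumes "(f has_vector_derivative f') (at s within S)"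
  shows "((\<lambda>s. exp (c * s) * (f s \<bullet> f s)) has_real_derivative
      exp (c * s) * (2 * (f s \<bullet> f') + c * (f s \<bullet> f s))) (at s within S)"
proof -
  have "((\<lambda>s. f s \<bullet> f s) has_real_derivative 2 * (f s \<bullet> f')) (at s within S)"
    using bounded_bilinear.has_vector_derivative[OF bounded_bilinear_inner assms assms]
    by (simp add: has_real_derivative_iff_has_vector_derivative inner_commute)
  then show ?thesis
    by (auto intro!: derivative_eq_intros simp: algebra_simps)
qed

lemma linearly_bounded_derivative_imp_zero:
  fixes f :: "real \<Rightarrow> 'a::real_inner"
  assumes der: "\<And>t. t \<in> {a..b} \<Longrightarrow> (f has_vector_derivative f' t) (at t within {a..b})"
    and bnd: "\<And>t. t \<in> {a..b} \<Longrightarrow> norm (f' t) \<le> K * norm (f t)"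
    and t0: "t0 \<in> {a..b}" "f t0 = 0" and t: "t \<in> {a..b}"
  shows "f t = 0"
proof -
  have growth: "f s \<bullet> f' s \<le> K * (f s \<bullet> f s)" "- (f s \<bullet> f' s) \<le> K * (f s \<bullet> f s)"
    if "s \<in> {a..b}" for s
  proof -
    have "\<bar>f s \<bullet> f' s\<bar> \<le> norm (f s) * norm (f' s)" by (rule Cauchy_Schwarz_ineq2)
    also have "\<dots> \<le> norm (f s) * (K * norm (f s))" using bnd[OF that] by (simp add: mult_left_mono)
    finally show "f s \<bullet> f' s \<le> K * (f s \<bullet> f s)" "- (f s \<bullet> f' s) \<le> K * (f s \<bullet> f s)"
      by (simp_all add: abs_le_iff power2_norm_eq_inner[symmetric] power2_eq_square algebra_simps)
  qed
  \<comment> \<open>Gronwall: \<open>exp (- 2 K s) \<parallel>f s\<parallel>\<^sup>2\<close> is nonincreasing and \<open>exp (2 K s) \<parallel>f s\<parallel>\<^sup>2\<close> nondecreasing\<close>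
  have "f t \<bullet> f t \<le> 0"
  proof (cases "t0 \<le> t")
    case True
    have "exp (- 2 * K * t) * (f t \<bullet> f t) \<le> exp (- 2 * K * t0) * (f t0 \<bullet> f t0)"
      by (rule has_real_derivative_nonpos_imp_antitone[OF
            exp_weighted_inner_self_has_derivative[OF der]])
        (use growth(1) True t0 t in \<open>auto intro!: mult_nonneg_nonpos\<close>)
    then show ?thesis using t0 by (simp add: mult_le_0_iff)
  next
    case False
    have "- (exp (2 * K * t0) * (f t0 \<bullet> f t0)) \<le> - (exp (2 * K * t) * (f t \<bullet> f t))"
    proof (rule has_real_derivative_nonpos_imp_antitone[OF
          DERIV_minus[OF exp_weighted_inner_self_has_derivative[OF der]]])
      fix s assume "s \<in> {a..b}"
      with growth(2)[OF this]
      show "- (exp (2 * K * s) * (2 * (f s \<bullet> f' s) + 2 * K * (f s \<bullet> f s))) \<le> 0"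
        by (auto intro!: mult_nonneg_nonneg)
    qed (use False t0 t in auto)
    then show ?thesis using t0 by (simp add: mult_le_0_iff)
  qed
  then show ?thesis by (metis inner_ge_zero inner_eq_zero_iff order_antisym)
qed

lemma norm_integral_exp_weighted_le:
  fixes h :: "real \<Rightarrow> 'a::banach"
  assumes L: "0 < L" and s: "0 \<le> s" and h: "h integrable_on {0..s}"
    and bound: "\<And>u. u \<in> {0..s} \<Longrightarrow> norm (h u) \<le> B * exp (L * u)"
  shows "exp (- L * s) * norm (integral {0..s} h) \<le> B / L"
proof -
  have B: "0 \<le> B" using order_trans[OF norm_ge_zero bound[of 0]] s by simp
  have "((\<lambda>u. B * exp (L * u)) has_integral B * exp (L * s) / L - B * exp (L * 0) / L) {0..s}"
    by (rule fundamental_theorem_of_calculus[OF s])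
      (use L in \<open>auto intro!: derivative_eq_intros
        simp: has_real_derivative_iff_has_vector_derivative[symmetric]\<close>)
  then have exp_int: "((\<lambda>u. B * exp (L * u)) has_integral B * (exp (L * s) - 1) / L) {0..s}"
    by (simp add: diff_divide_distrib right_diff_distrib)
  have "norm (integral {0..s} h) \<le> B * (exp (L * s) - 1) / L"
    using integral_norm_bound_integral[OF h has_integral_integrable[OF exp_int] bound]
      integral_unique[OF exp_int] by simp
  then have "exp (- L * s) * norm (integral {0..s} h) \<le> exp (- L * s) * (B * (exp (L * s) - 1) / L)"
    by (rule mult_left_mono) simp
  also have "\<dots> = B * (1 - exp (- L * s)) / L"
    using L by (simp add: field_simps exp_minus)
  also have "\<dots> \<le> B / L"
    using B L by (intro divide_right_mono mult_left_le) auto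
  finally show ?thesis .
qed

lemma clamp_real_in_Icc:
  fixes a b t :: real
  assumes "a \<le> b"
  shows "clamp a b t \<in> {a..b}"
  using clamp_in_interval[of a b t] assms by (simp add: cbox_interval)

lemma clamp_comp_in_bcontfun:
  fixes f :: "real \<Rightarrow> 'a::metric_space"
  assumes ab: "a \<le> b" and f: "continuous_on {a..b} f"
  shows "(\<lambda>t. f (clamp a b t)) \<in> bcontfun"
  unfolding bcontfun_def
proof (intro CollectI conjI)
  show "continuous_on UNIV (\<lambda>t. f (clamp a b t))"
    using continuous_on_ext_cont[of a b f] f unfolding ext_cont_def by (simp add: cbox_interval)
  have "bounded (f ` {a..b})"
    by (intro compact_imp_bounded compact_continuous_image f compact_Icc)
  moreover have "range (\<lambda>t. f (clamp a b t)) \<subseteq> f ` {a..b}"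
    using clamp_real_in_Icc[OF ab] by auto
  ultimately show "bounded (range (\<lambda>t. f (clamp a b t)))"
    by (rule bounded_subset)
qed

lemma exp_weighted_volterra_lipschitz:
  fixes M :: "real \<Rightarrow> real^'l^'l" and y1 y2 :: "real \<Rightarrow>\<^sub>C (real^'l)"
  assumes M: "continuous_on {0..b} M"
    and K: "0 \<le> K" "\<And>t v. t \<in> {0..b} \<Longrightarrow> norm (M t *v v) \<le> K * norm v"
    and L: "0 < L" and s: "s \<in> {0..b}"
  shows "exp (- L * s) * norm (integral {0..s} (\<lambda>u. M u *v (exp (L * u) *\<^sub>R (y1 u - y2 u))))
    \<le> K * dist y1 y2 / L"
proof (rule norm_integral_exp_weighted_le[OF L])
  show "(\<lambda>u. M u *v (exp (L * u) *\<^sub>R (y1 u - y2 u))) integrable_on {0..s}"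
    using s by (intro integrable_continuous_interval continuous_intros continuous_on_apply_bcontfun
        continuous_on_subset[OF M]) auto
  fix u assume u: "u \<in> {0..s}"
  have "norm (M u *v (exp (L * u) *\<^sub>R (y1 u - y2 u))) \<le> K * (exp (L * u) * norm (y1 u - y2 u))"
    using K(2)[of u "exp (L * u) *\<^sub>R (y1 u - y2 u)"] u s by simp
  also have "\<dots> \<le> K * (exp (L * u) * dist y1 y2)"
    using dist_bounded[of y1 u y2] K(1) by (intro mult_left_mono) (auto simp: dist_norm)
  finally show "norm (M u *v (exp (L * u) *\<^sub>R (y1 u - y2 u))) \<le> K * dist y1 y2 * exp (L * u)"
    by (simp add: algebra_simps)
qed (use s in auto)

lemma exp_weighted_picard_fixed_point:
  fixes M :: "real \<Rightarrow> real^'l^'l" and z :: "real^'l"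
  assumes b: "0 \<le> b" and M: "continuous_on {0..b} M"
    and K: "0 \<le> K" "\<And>t v. t \<in> {0..b} \<Longrightarrow> norm (M t *v v) \<le> K * norm v"
    and L: "0 < L" "K / L \<le> 1 / 2"
  shows "\<exists>y :: real \<Rightarrow>\<^sub>C (real^'l). \<forall>t\<in>{0..b}.
    exp (L * t) *\<^sub>R y t = z + integral {0..t} (\<lambda>s. M s *v (exp (L * s) *\<^sub>R y s))"
proof -
  define G where "G y = (\<lambda>s. M s *v (exp (L * s) *\<^sub>R apply_bcontfun y s))"
    for y :: "real \<Rightarrow>\<^sub>C (real^'l)"
  define F where "F y t = exp (- L * t) *\<^sub>R (z + integral {0..t} (G y))" for y t
  have G_cont: "continuous_on {0..b} (G y)" for y
    unfolding G_def by (intro continuous_intros M continuous_on_apply_bcontfun)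
  have G_int: "G y integrable_on {0..s}" if "s \<in> {0..b}" for y s
    using that by (intro integrable_continuous_interval continuous_on_subset[OF G_cont]) auto
  have F_cont: "continuous_on {0..b} (F y)" for y
    unfolding F_def
    by (intro continuous_intros indefinite_integral_continuous_1
        integrable_continuous_interval G_cont)
  \<comment> \<open>Picard map for \<open>y t = exp (- L t) x t\<close>, frozen outside \<open>[0, b]\<close>; the weight makes it
    a contraction in the sup norm\<close>
  define \<Phi> where "\<Phi> y = Bcontfun (\<lambda>t. F y (clamp 0 b t))" for y
  have \<Phi>: "apply_bcontfun (\<Phi> y) t = F y (clamp 0 b t)" for y t
    unfolding \<Phi>_def using clamp_comp_in_bcontfun[OF b F_cont] by (simp add: Bcontfun_inverse)
  have "dist (\<Phi> y1) (\<Phi> y2) \<le> 1 / 2 * dist y1 y2" for y1 y2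
  proof (rule dist_bound)
    fix t
    define s where "s = clamp 0 b t"
    have s: "s \<in> {0..b}" using clamp_real_in_Icc[OF b] by (simp add: s_def)
    have "\<Phi> y1 t - \<Phi> y2 t = exp (- L * s) *\<^sub>R integral {0..s} (\<lambda>u. G y1 u - G y2 u)"
      using G_int[OF s] by (simp add: \<Phi> F_def s_def[symmetric] integral_diff algebra_simps)
    also have "(\<lambda>u. G y1 u - G y2 u) = (\<lambda>u. M u *v (exp (L * u) *\<^sub>R (y1 u - y2 u)))"
      by (simp add: G_def algebra_simps)
    finally have "dist (\<Phi> y1 t) (\<Phi> y2 t)
        = exp (- L * s) * norm (integral {0..s} (\<lambda>u. M u *v (exp (L * u) *\<^sub>R (y1 u - y2 u))))"
      by (simp add: dist_norm)
    also have "\<dots> \<le> K * dist y1 y2 / L"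
      by (rule exp_weighted_volterra_lipschitz[OF M K L(1) s])
    also have "\<dots> \<le> 1 / 2 * dist y1 y2"
      using mult_right_mono[OF L(2) zero_le_dist[of y1 y2]] by simp
    finally show "dist (\<Phi> y1 t) (\<Phi> y2 t) \<le> 1 / 2 * dist y1 y2" .
  qed
  then obtain y where y: "\<Phi> y = y"
    using banach_fix_type[of "1 / 2" \<Phi>] by auto
  show ?thesis
  proof (intro exI ballI)
    fix t assume "t \<in> {0..b}"
    then show "exp (L * t) *\<^sub>R y t = z + integral {0..t} (\<lambda>s. M s *v (exp (L * s) *\<^sub>R y s))"
      using \<Phi>[of y t] clamp_cancel_cbox[of t 0 b]
      by (simp add: y F_def G_def cbox_interval mult_exp_exp)
  qed
qed

lemma linear_volterra_solution_exists:
  fixes M :: "real \<Rightarrow> real^'l^'l" and z :: "real^'l"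
  assumes b: "0 \<le> b" and M: "continuous_on {0..b} M"
  obtains x where "continuous_on {0..b} x"
    and "\<And>t. t \<in> {0..b} \<Longrightarrow> x t = z + integral {0..t} (\<lambda>s. M s *v x s)"
proof -
  obtain K where K: "0 \<le> K" "\<And>t v. t \<in> {0..b} \<Longrightarrow> norm (M t *v v) \<le> K * norm v"
    by (rule bounded_bilinear_compact_bound[OF bounded_bilinear_matrix_vector_mult compact_Icc M])
      blast
  define L where "L = 2 * K + 1"
  have L: "0 < L" "K / L \<le> 1 / 2" using K(1) by (auto simp: L_def field_simps)
  obtain y :: "real \<Rightarrow>\<^sub>C (real^'l)" where y: "\<And>t. t \<in> {0..b} \<Longrightarrow>
      exp (L * t) *\<^sub>R y t = z + integral {0..t} (\<lambda>s. M s *v (exp (L * s) *\<^sub>R y s))"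
    using exp_weighted_picard_fixed_point[OF b M K L] by blast
  show thesis
  proof
    show "continuous_on {0..b} (\<lambda>t. exp (L * t) *\<^sub>R y t)"
      by (intro continuous_intros continuous_on_apply_bcontfun)
  qed (rule y)
qed

lemma linear_ode_solution_exists:
  fixes M :: "real \<Rightarrow> real^'l^'l" and z :: "real^'l"
  assumes b: "0 \<le> b" and M: "continuous_on {0..b} M"
  obtains x where "x 0 = z"
    and "\<And>t. t \<in> {0..b} \<Longrightarrow> (x has_vector_derivative M t *v x t) (at t within {0..b})"
proof -
  obtain x where x_cont: "continuous_on {0..b} x"
    and x: "\<And>t. t \<in> {0..b} \<Longrightarrow> x t = z + integral {0..t} (\<lambda>s. M s *v x s)"
    using linear_volterra_solution_exists[OF b M] by blast
  show thesis
  proof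
    show "x 0 = z" using x[of 0] b by simp
    fix t assume t: "t \<in> {0..b}"
    have "continuous_on {0..b} (\<lambda>s. M s *v x s)" by (intro continuous_intros M x_cont)
    from integral_has_vector_derivative[OF this t]
    have "((\<lambda>u. z + integral {0..u} (\<lambda>s. M s *v x s)) has_vector_derivative 0 + M t *v x t)
        (at t within {0..b})"
      by (rule has_vector_derivative_add[OF has_vector_derivative_const])
    then have "((\<lambda>u. z + integral {0..u} (\<lambda>s. M s *v x s)) has_vector_derivative M t *v x t)
        (at t within {0..b})"
      by (simp only: add_0_left)
    from has_vector_derivative_transform[OF t x this]
    show "(x has_vector_derivative M t *v x t) (at t within {0..b})" .
  qed
qed

lemma linear_ode_solution_eq_zero:
  fixes A :: "real \<Rightarrow> real^'l^'l"
  assumes A: "continuous_on {a..b} A"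
    and x': "\<And>t. t \<in> {a..b} \<Longrightarrow> (x has_vector_derivative A t *v x t) (at t within {a..b})"
    and t1: "t1 \<in> {a..b}" "x t1 = 0" and t: "t \<in> {a..b}"
  shows "x t = 0"
proof -
  obtain K where K: "\<And>s v. s \<in> {a..b} \<Longrightarrow> norm (A s *v v) \<le> K * norm v"
    by (rule bounded_bilinear_compact_bound[OF bounded_bilinear_matrix_vector_mult compact_Icc A])
      blast
  show ?thesis
    by (rule linearly_bounded_derivative_imp_zero[OF x' K t1 t])
qed

lemma AE_lborel_Icc_imp_ex:
  fixes a b :: real
  assumes "AE t in lborel. t \<in> {a..b} \<longrightarrow> P t" and "a < b"
  shows "\<exists>t\<in>{a..b}. P t"
proof (rule ccontr)
  assume "\<not> (\<exists>t\<in>{a..b}. P t)"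
  with assms(1) have "AE t in lborel. t \<notin> {a..b}"
    by (auto elim: eventually_mono)
  then have "emeasure lborel {a..b} = 0"
    by (subst (asm) AE_iff_measurable[of "{a..b}"]) auto
  with assms(2) show False by (simp add: emeasure_lborel_Icc[of a b])
qed

definition riccati_rhs :: "real^'l^'l \<Rightarrow> real^'n^'l \<Rightarrow> real^'l^'m \<Rightarrow> real^'l^'l \<Rightarrow> real^'l^'l"
  where "riccati_rhs A B C X =
    - (transpose A ** X) - X ** A - transpose C ** C + X ** B ** transpose B ** X"

lemma transpose_riccati_rhs:
  "transpose (riccati_rhs A B C X) = riccati_rhs A B C (transpose X)"
  by (simp add: riccati_rhs_def transpose_add transpose_diff transpose_uminus matrix_transpose_mul
      matrix_mul_assoc)

lemma riccati_rhs_diff: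
  "riccati_rhs A B C X - riccati_rhs A B C Y
    = (Y ** B ** transpose B - transpose A) ** (X - Y) + (X - Y) ** (B ** transpose B ** X - A)"
  by (simp add: riccati_rhs_def matrix_mult_distribs matrix_mul_assoc)

lemma riccati_solution_unique:
  fixes A :: "real \<Rightarrow> real^'l^'l" and B :: "real^'n^'l" and C :: "real \<Rightarrow> real^'l^'m"
  assumes P': "\<And>t. t \<in> {a..b} \<Longrightarrow>
      (P has_vector_derivative riccati_rhs (A t) B (C t) (P t)) (at t within {a..b})"
    and Q': "\<And>t. t \<in> {a..b} \<Longrightarrow>
      (Q has_vector_derivative riccati_rhs (A t) B (C t) (Q t)) (at t within {a..b})"
    and A: "continuous_on {a..b} A"
    and t1: "t1 \<in> {a..b}" "P t1 = Q t1" and t: "t \<in> {a..b}"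
  shows "P t = Q t"
proof -
  define X where "X s = Q s ** B ** transpose B - transpose (A s)" for s
  define Y where "Y s = B ** transpose B ** P s - A s" for s
  have P_cont: "continuous_on {a..b} P"
    by (rule has_vector_derivative_imp_continuous_on[OF P'])
  have Q_cont: "continuous_on {a..b} Q"
    by (rule has_vector_derivative_imp_continuous_on[OF Q'])
  have "continuous_on {a..b} X"
    unfolding X_def by (intro continuous_intros Q_cont A)
  then obtain KX where KX: "\<And>s (D :: real^'l^'l). s \<in> {a..b} \<Longrightarrow> norm (X s ** D) \<le> KX * norm D"
    by (rule bounded_bilinear_compact_bound[OF bounded_bilinear_matrix_matrix_mult compact_Icc])
      blast
  have "continuous_on {a..b} Y"
    unfolding Y_def by (intro continuous_intros P_cont A)
  then obtain KY where KY: "\<And>s (D :: real^'l^'l). s \<in> {a..b} \<Longrightarrow> norm (D ** Y s) \<le> KY * norm D"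
    by (rule bounded_bilinear_compact_bound[OF
          bounded_bilinear.flip[OF bounded_bilinear_matrix_matrix_mult] compact_Icc]) blast
  have "P t - Q t = 0"
  proof (rule linearly_bounded_derivative_imp_zero
      [where f' = "\<lambda>s. X s ** (P s - Q s) + (P s - Q s) ** Y s" and K = "KX + KY"])
    fix s assume s: "s \<in> {a..b}"
    show "((\<lambda>s. P s - Q s) has_vector_derivative X s ** (P s - Q s) + (P s - Q s) ** Y s)
        (at s within {a..b})"
      using has_vector_derivative_diff[OF P'[OF s] Q'[OF s]]
      by (simp add: riccati_rhs_diff X_def Y_def)
    show "norm (X s ** (P s - Q s) + (P s - Q s) ** Y s) \<le> (KX + KY) * norm (P s - Q s)"
      using norm_triangle_ineq[of "X s ** (P s - Q s)" "(P s - Q s) ** Y s"]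
        KX[OF s, of "P s - Q s"] KY[OF s, of "P s - Q s"]
      unfolding distrib_right by linarith
  qed (use t1 t in auto)
  then show ?thesis by simp
qed

lemma riccati_solution_symmetric:
  fixes A :: "real \<Rightarrow> real^'l^'l" and B :: "real^'n^'l" and C :: "real \<Rightarrow> real^'l^'m"
  assumes P': "\<And>t. t \<in> {a..b} \<Longrightarrow>
      (P has_vector_derivative riccati_rhs (A t) B (C t) (P t)) (at t within {a..b})"
    and A: "continuous_on {a..b} A"
    and t1: "t1 \<in> {a..b}" "transpose (P t1) = P t1" and t: "t \<in> {a..b}"
  shows "transpose (P t) = P t"
proof (rule riccati_solution_unique[where P = "\<lambda>s. transpose (P s)", OF _ P' A t1 t])
  fix s assume "s \<in> {a..b}"
  from bounded_linear.has_vector_derivative[OF bounded_linear_transpose P'[OF this]]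
  show "((\<lambda>s. transpose (P s)) has_vector_derivative riccati_rhs (A s) B (C s) (transpose (P s)))
      (at s within {a..b})"
    by (simp add: transpose_riccati_rhs)
qed

lemma riccati_closed_loop_value_derivative:
  fixes A :: "real^'l^'l" and B :: "real^'n^'l" and C :: "real^'l^'m"
  assumes P': "(P has_vector_derivative riccati_rhs A B C (P t)) (at t within S)"
    and x': "(x has_vector_derivative (A - B ** transpose B ** P t) *v x t) (at t within S)"
  shows "((\<lambda>s. x s \<bullet> (P s *v x s)) has_real_derivative
      - ((C *v x t) \<bullet> (C *v x t) + (transpose B *v (P t *v x t)) \<bullet> (transpose B *v (P t *v x t))))
      (at t within S)"
proof -
  define y where "y = P t *v x t"
  define u where "u = transpose B *v y"
  have "((\<lambda>s. x s \<bullet> (P s *v x s)) has_vector_derivative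
      x t \<bullet> (P t *v ((A - B ** transpose B ** P t) *v x t) + riccati_rhs A B C (P t) *v x t)
      + ((A - B ** transpose B ** P t) *v x t) \<bullet> (P t *v x t)) (at t within S)"
    by (intro bounded_bilinear.has_vector_derivative[OF bounded_bilinear_inner]
        bounded_bilinear.has_vector_derivative[OF bounded_bilinear_matrix_vector_mult] x' P')
  moreover have "x t \<bullet> (transpose A *v y) = (A *v x t) \<bullet> y"
    by (subst inner_matrix_vector_transpose) simp
  moreover have "x t \<bullet> (transpose C *v (C *v x t)) = (C *v x t) \<bullet> (C *v x t)"
    by (subst inner_matrix_vector_transpose) simp
  moreover have "(B *v u) \<bullet> y = u \<bullet> u"
    by (subst inner_commute, subst inner_matrix_vector_transpose) (simp add: u_def)
  ultimately show ?thesis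
    by (simp add: has_real_derivative_iff_has_vector_derivative riccati_rhs_def y_def[symmetric]
        u_def[symmetric] matrix_vector_mult_diff_rdistrib matrix_vector_mult_add_rdistrib
        matrix_vector_mul_assoc[symmetric] matrix_vector_right_distrib
        matrix_vector_mult_diff_distrib
        inner_add_right inner_diff_right inner_diff_left
        bounded_bilinear.minus_left[OF bounded_bilinear_matrix_vector_mult]
        del: transpose_matrix_vector vector_transpose_matrix)
qed

lemma riccati_nonpos_value_imp_unobservable:
  fixes A :: "real \<Rightarrow> real^'l^'l" and B :: "real^'n^'l" and C :: "real \<Rightarrow> real^'l^'m"
  assumes b: "0 < b"
    and P': "\<And>t. t \<in> {0..b} \<Longrightarrow>
      (P has_vector_derivative riccati_rhs (A t) B (C t) (P t)) (at t within {0..b})"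
    and P_end: "P b = 0" and A: "continuous_on {0..b} A"
    and nonpos: "z0 \<bullet> (P 0 *v z0) \<le> 0"
  obtains x where "x 0 = z0"
    and "\<And>t. t \<in> {0..b} \<Longrightarrow> (x has_vector_derivative A t *v x t) (at t within {0..b})"
    and "\<And>t. t \<in> {0..b} \<Longrightarrow> C t *v x t = 0"
proof -
  have closed_loop_cont: "continuous_on {0..b} (\<lambda>t. A t - B ** transpose B ** P t)"
    by (intro continuous_intros A has_vector_derivative_imp_continuous_on[OF P'])
  obtain x where x0: "x 0 = z0" and x': "\<And>t. t \<in> {0..b} \<Longrightarrow>
      (x has_vector_derivative (A t - B ** transpose B ** P t) *v x t) (at t within {0..b})"
    by (rule linear_ode_solution_exists[where z = z0, OF less_imp_le[OF b] closed_loop_cont]) blast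
  define V where "V s = x s \<bullet> (P s *v x s)" for s
  define W where "W s = (C s *v x s) \<bullet> (C s *v x s)
      + (transpose B *v (P s *v x s)) \<bullet> (transpose B *v (P s *v x s))" for s
  have V': "(V has_real_derivative - W t) (at t within {0..b})" if "t \<in> {0..b}" for t
    unfolding V_def W_def by (rule riccati_closed_loop_value_derivative[OF P'[OF that] x'[OF that]])
  have W_nonneg: "0 \<le> W t" for t by (simp add: W_def)
  \<comment> \<open>\<open>V\<close> is nonincreasing, but \<open>V 0 \<le> 0 = V b\<close>\<close>
  have W_zero: "W t = 0" if "t \<in> {0..b}" for t
  proof -
    have "V 0 \<le> V b" using nonpos x0 P_end by (simp add: V_def)
    from has_real_derivative_nonpos_imp_zero[OF b V' _ this that] W_nonneg show ?thesis by simp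
  qed
  have Cx: "C t *v x t = 0" and BPx: "transpose B *v (P t *v x t) = 0" if "t \<in> {0..b}" for t
    using W_zero[OF that] W_nonneg
    by (simp_all add: W_def add_nonneg_eq_0_iff del: transpose_matrix_vector)
  show thesis
  proof (rule that[OF x0 _ Cx])
    fix t assume "t \<in> {0..b}"
    with x'[OF this] BPx[OF this] show "(x has_vector_derivative A t *v x t) (at t within {0..b})"
      by (simp add: matrix_vector_mult_diff_rdistrib matrix_vector_mul_assoc[symmetric]
          del: transpose_matrix_vector vector_transpose_matrix)
  qed
qed

lemma vector_matrix_obs_blk_eq_zero:
  fixes A :: "real \<Rightarrow> real^'l^'l" and C :: "real \<Rightarrow> real^'l^'m"
  assumes ab: "a < b"
    and x': "\<And>t. t \<in> {a..b} \<Longrightarrow> (x has_vector_derivative A t *v x t) (at t within {a..b})"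
    and Cx: "\<And>t. t \<in> {a..b} \<Longrightarrow> C t *v x t = 0"
    and diff: "\<And>i t. i < j \<Longrightarrow> t \<in> {a..b} \<Longrightarrow>
      obs_blk A C {a..b} i differentiable (at t within {a..b})"
    and t: "t \<in> {a..b}"
  shows "x t v* obs_blk A C {a..b} j t = 0"
  using diff t
proof (induction j arbitrary: t)
  case 0
  then show ?case using Cx by simp
next
  case (Suc j)
  define Q where "Q = obs_blk A C {a..b} j"
  define Q' where "Q' = vector_derivative Q (at t within {a..b})"
  have "(Q has_vector_derivative Q') (at t within {a..b})"
    using Suc.prems unfolding Q_def Q'_def by (simp add: vector_derivative_works)
  then have "((\<lambda>s. x s v* Q s) has_vector_derivative x t v* Q' + (A t *v x t) v* Q t)
      (at t within cbox a b)"
    using bounded_bilinear.has_vector_derivative[OF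
        bounded_bilinear_vector_matrix_mult x'[OF Suc.prems(2)]]
    by (simp add: cbox_interval)
  moreover have "((\<lambda>s. x s v* Q s) has_vector_derivative 0) (at t within cbox a b)"
    using Suc by (intro has_vector_derivative_transform[OF _ _ has_vector_derivative_const])
      (auto simp: Q_def cbox_interval)
  moreover have "t \<in> cbox a b" using Suc.prems by (simp add: cbox_interval)
  ultimately have "x t v* Q' + (A t *v x t) v* Q t = 0"
    using vector_derivative_unique_within_closed_interval[OF ab] by blast
  moreover have "x t v* obs_blk A C {a..b} (Suc j) t = x t v* Q' + (A t *v x t) v* Q t"
    by (simp add: Q_def Q'_def vector_matrix_mult_add_rdistrib vector_matrix_mul_assoc[symmetric])
  ultimately show ?case by simp
qed

lemma vector_matrix_obs_mat_eq_zero: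
  fixes A :: "real \<Rightarrow> real^'l^'l" and C :: "real \<Rightarrow> real^'l^'m"
  assumes ab: "a < b"
    and x': "\<And>t. t \<in> {a..b} \<Longrightarrow> (x has_vector_derivative A t *v x t) (at t within {a..b})"
    and Cx: "\<And>t. t \<in> {a..b} \<Longrightarrow> C t *v x t = 0"
    and diff: "\<And>i t. i < CARD('l) - 1 \<Longrightarrow> t \<in> {a..b} \<Longrightarrow>
      obs_blk A C {a..b} i differentiable (at t within {a..b})"
    and t: "t \<in> {a..b}"
  shows "x t v* obs_mat A C {a..b} t = 0"
proof -
  have "x t v* obs_blk A C {a..b} j t = 0" if "j < CARD('l)" for j
    using that diff by (intro vector_matrix_obs_blk_eq_zero[OF ab x' Cx _ t]) auto
  moreover have "to_nat_on (UNIV :: 'l set) i < CARD('l)" for i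
    using bij_betwE[OF to_nat_on_finite[of "UNIV :: 'l set"]] by auto
  ultimately show ?thesis
    by (simp add: vec_eq_iff vector_matrix_mult_def obs_mat_def)
qed

lemma full_rank_gram_eq_zero:
  fixes N :: "real^'s^'l" and Q :: "real^'c^'l"
  assumes "rank (transpose N ** Q ** transpose Q ** N) = CARD('s)" and "(N *v w) v* Q = 0"
  shows "w = 0"
proof -
  have "(transpose N ** Q ** transpose Q ** N) *v w = 0"
    using assms(2) by (simp add: matrix_vector_mul_assoc[symmetric])
  with assms(1) show ?thesis
    unfolding full_rank_injective by (metis injD matrix_vector_mult_0_right)
qed

lemma linear_ode_Inl_component_constant:
  fixes A :: "real \<Rightarrow> real^('k::finite + 'n::finite)^('k + 'n)"
  assumes A_Inl: "\<And>t v i. (A t *v v) $ Inl i = 0"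
    and x': "\<And>t. t \<in> {a..b} \<Longrightarrow> (x has_vector_derivative A t *v x t) (at t within {a..b})"
    and s: "s \<in> {a..b}" and t: "t \<in> {a..b}"
  shows "x t $ Inl i = x s $ Inl i"
proof -
  have "((\<lambda>s. x s $ Inl i) has_field_derivative 0) (at t within {a..b})" if "t \<in> {a..b}" for t
    using bounded_linear.has_vector_derivative[OF bounded_linear_vec_nth x'[OF that], of "Inl i"]
    by (simp add: A_Inl has_real_derivative_iff_has_vector_derivative)
  then obtain c where "\<forall>t\<in>{a..b}. x t $ Inl i = c"
    using has_field_derivative_zero_constant[OF convex_real_interval(5)] by blast
  with s t show ?thesis by simp
qed

lemma Amat_mult_vec_Inl: "(Amat Jxphi Jxf t *v v) $ Inl i = 0"
  by (simp add: Amat_def matrix_vector_mult_def)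

lemma diag_mat_mult_vec: "diag_mat v *v z = (\<chi> r. v $ r * z $ r)"
  by (simp add: vec_eq_iff diag_mat_def matrix_vector_mult_def if_distrib[of "\<lambda>a. a * _"]
      cong: if_cong)

lemma diag_mat_ext_zero_mult_eq_0_iff:
  "diag_mat (ext_zero cb :: real^('k::finite + 'n::finite)) *v z = 0
    \<longleftrightarrow> (\<forall>i. cb $ i \<noteq> 0 \<longrightarrow> z $ Inl i = 0)"
  by (auto simp: diag_mat_mult_vec vec_eq_iff ext_zero_def split: sum.split)

lemma ioc_feasible_iff:
  "ioc_feasible cb z
    \<longleftrightarrow> diag_mat (ext_zero cb :: real^('k::finite + 'n::finite)) *v (z - ext_zero cb) = 0"
  unfolding diag_mat_ext_zero_mult_eq_0_iff by (simp add: ioc_feasible_def ext_zero_def)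

lemma riccati_value_pos_if_observable:
  fixes A :: "real \<Rightarrow> real^('k::finite + 'n::finite)^('k + 'n)" and B :: "real^'p^('k + 'n)"
    and C :: "real \<Rightarrow> real^('k + 'n)^'m::finite" and Ns :: "real^'s::finite^('k + 'n)"
  assumes T: "0 < T" "T \<le> b"
    and A: "continuous_on {0..b} A" and A_Inl: "\<And>t v i. (A t *v v) $ Inl i = 0"
    and diff: "\<And>j t. j < CARD('k + 'n) - 1 \<Longrightarrow> t \<in> {0..b} \<Longrightarrow>
      obs_blk A C {0..b} j differentiable (at t within {0..b})"
    and P': "\<And>t. t \<in> {0..b} \<Longrightarrow>
      (P has_vector_derivative riccati_rhs (A t) B (C t) (P t)) (at t within {0..b})"
    and P_end: "P b = 0"
    and Ns_ker: "range ((*v) Ns) = {z. diag_mat (ext_zero cbar :: real^('k + 'n)) *v z = 0}"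
    and full: "AE t in lborel. t \<in> {0..T} \<longrightarrow>
      rank (transpose Ns ** obs_mat A C {0..b} t ** transpose (obs_mat A C {0..b} t) ** Ns)
        = CARD('s)"
    and z0: "z0 \<in> range ((*v) Ns)" "z0 \<noteq> 0"
  shows "0 < z0 \<bullet> (P 0 *v z0)"
proof (rule ccontr)
  have b: "0 < b" using T by simp
  assume "\<not> 0 < z0 \<bullet> (P 0 *v z0)"
  then have nonpos: "z0 \<bullet> (P 0 *v z0) \<le> 0" by simp
  obtain x where x0: "x 0 = z0"
    and x': "\<And>t. t \<in> {0..b} \<Longrightarrow> (x has_vector_derivative A t *v x t) (at t within {0..b})"
    and Cx: "\<And>t. t \<in> {0..b} \<Longrightarrow> C t *v x t = 0"
    using riccati_nonpos_value_imp_unobservable[OF b P' P_end A nonpos] by metis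
  \<comment> \<open>the known weights do not move, so the unobservable trajectory stays in the range of \<open>Ns\<close>\<close>
  have "x t \<in> range ((*v) Ns)" if "t \<in> {0..b}" for t
  proof -
    have "x t $ Inl i = z0 $ Inl i" for i
      using linear_ode_Inl_component_constant[OF A_Inl x' _ that, of 0] b x0 by simp
    with z0(1) show ?thesis
      unfolding Ns_ker by (simp add: diag_mat_ext_zero_mult_eq_0_iff)
  qed
  moreover obtain t1 where t1: "t1 \<in> {0..T}" and rank:
    "rank (transpose Ns ** obs_mat A C {0..b} t1 ** transpose (obs_mat A C {0..b} t1) ** Ns)
      = CARD('s)"
    using AE_lborel_Icc_imp_ex[OF full T(1)] by blast
  moreover have t1_b: "t1 \<in> {0..b}" using t1 T by simp
  ultimately obtain w where w: "x t1 = Ns *v w" by blast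
  have "w = 0"
    using full_rank_gram_eq_zero[OF rank] vector_matrix_obs_mat_eq_zero[OF b x' Cx diff t1_b]
    by (simp add: w)
  then have "x 0 = 0"
    using linear_ode_solution_eq_zero[OF A x' t1_b] w b by simp
  with x0 z0(2) show False by simp
qed

lemma pos_def_mat_congruence:
  fixes Q :: "real^'l^'l" and N :: "real^'s^'l"
  assumes sym: "transpose Q = Q" and pos: "\<And>w. w \<noteq> 0 \<Longrightarrow> 0 < (N *v w) \<bullet> (Q *v (N *v w))"
  shows "pos_def_mat (transpose N ** Q ** N)"
  unfolding pos_def_mat_def
proof (intro conjI allI impI)
  show "transpose (transpose N ** Q ** N) = transpose N ** Q ** N"
    by (simp add: matrix_transpose_mul sym matrix_mul_assoc)
  fix w :: "real^'s" assume "w \<noteq> 0"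
  have "w \<bullet> ((transpose N ** Q ** N) *v w) = (N *v w) \<bullet> (Q *v (N *v w))"
    by (simp add: matrix_vector_mul_assoc[symmetric]) (metis dot_lmul_matrix inner_commute)
  with pos[OF \<open>w \<noteq> 0\<close>] show "0 < w \<bullet> ((transpose N ** Q ** N) *v w)" by simp
qed

lemma pos_def_mat_surj:
  assumes "pos_def_mat H"
  shows "surj ((*v) H)"
proof -
  have "inj ((*v) H)"
  proof (rule injI)
    fix u v assume "H *v u = H *v v"
    then have "(u - v) \<bullet> (H *v (u - v)) = 0" by (simp add: matrix_vector_mult_diff_distrib)
    with assms show "u = v" unfolding pos_def_mat_def by (metis less_irrefl right_minus_eq)
  qed
  then show ?thesis
    using full_rank_injective[of H] full_rank_surjective[of H] by simp
qed

lemma quadratic_form_add_orthogonal: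
  fixes Q :: "real^'l^'l"
  assumes "transpose Q = Q" and "d \<bullet> (Q *v z) = 0"
  shows "(z + d) \<bullet> (Q *v (z + d)) = z \<bullet> (Q *v z) + d \<bullet> (Q *v d)"
  using assms inner_matrix_vector_symmetric[OF assms(1), of z d]
  by (simp add: matrix_vector_right_distrib inner_add_left inner_add_right)

lemma quadratic_form_orthogonal_point_exists:
  fixes Q :: "real^'l^'l" and N :: "real^'s^'l"
  assumes sym: "transpose Q = Q" and pos: "\<And>w. w \<noteq> 0 \<Longrightarrow> 0 < (N *v w) \<bullet> (Q *v (N *v w))"
  shows "\<exists>zs. (\<forall>z. z - c \<in> range ((*v) N) \<longleftrightarrow> (\<exists>v. z = zs + N *v v))
    \<and> (\<forall>v. (N *v v) \<bullet> (Q *v zs) = 0)"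
proof -
  obtain w where w: "(transpose N ** Q ** N) *v w = - (transpose N *v (Q *v c))"
    using pos_def_mat_surj[OF pos_def_mat_congruence[OF sym pos]] by (metis surjD)
  define zs where "zs = c + N *v w"
  show ?thesis
  proof (intro exI conjI allI)
    fix z
    show "z - c \<in> range ((*v) N) \<longleftrightarrow> (\<exists>v. z = zs + N *v v)"
    proof
      assume "z - c \<in> range ((*v) N)"
      then obtain u where "z - c = N *v u" by blast
      then have "z = c + N *v u" by (metis add.commute diff_add_cancel)
      then have "z = zs + N *v (u - w)"
        by (simp add: zs_def matrix_vector_mult_diff_distrib)
      then show "\<exists>v. z = zs + N *v v" ..
    next
      assume "\<exists>v. z = zs + N *v v"
      then obtain v where "z = zs + N *v v" ..
      then have "z - c = N *v (w + v)"
        by (simp add: zs_def matrix_vector_right_distrib)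
      then show "z - c \<in> range ((*v) N)" by blast
    qed
  next
    fix v
    have "transpose N *v (Q *v zs) = 0"
      using w by (simp add: zs_def matrix_vector_right_distrib matrix_vector_mul_assoc[symmetric]
          del: transpose_matrix_vector)
    then show "(N *v v) \<bullet> (Q *v zs) = 0"
      by (metis inner_matrix_vector_transpose inner_zero_left transpose_transpose inner_commute)
  qed
qed

lemma quadratic_form_unique_min_on_affine:
  fixes Q :: "real^'l^'l" and N :: "real^'s^'l"
  assumes sym: "transpose Q = Q" and pos: "\<And>w. w \<noteq> 0 \<Longrightarrow> 0 < (N *v w) \<bullet> (Q *v (N *v w))"
  shows "\<exists>!z. z - c \<in> range ((*v) N) \<and>
    (\<forall>z'. z' - c \<in> range ((*v) N) \<longrightarrow> z \<bullet> (Q *v z) \<le> z' \<bullet> (Q *v z'))"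
proof -
  obtain zs where feasible: "\<And>z. z - c \<in> range ((*v) N) \<longleftrightarrow> (\<exists>v. z = zs + N *v v)"
    and orth: "\<And>v. (N *v v) \<bullet> (Q *v zs) = 0"
    using quadratic_form_orthogonal_point_exists[OF sym pos] by blast
  have expand: "(zs + N *v v) \<bullet> (Q *v (zs + N *v v)) = zs \<bullet> (Q *v zs) + (N *v v) \<bullet> (Q *v (N *v v))"
    for v by (rule quadratic_form_add_orthogonal[OF sym orth])
  have zs_feasible: "zs - c \<in> range ((*v) N)"
    using feasible[of zs] matrix_vector_mult_0_right[of N] by (metis add_0_right)
  have nonneg: "0 \<le> (N *v v) \<bullet> (Q *v (N *v v))" for v
    using pos[of v] by (cases "v = 0") auto
  show ?thesis
  proof (rule ex1I[of _ zs])
    show "zs - c \<in> range ((*v) N) \<and>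
        (\<forall>z'. z' - c \<in> range ((*v) N) \<longrightarrow> zs \<bullet> (Q *v zs) \<le> z' \<bullet> (Q *v z'))"
      using zs_feasible expand nonneg by (auto simp: feasible)
  next
    fix z assume z: "z - c \<in> range ((*v) N) \<and>
        (\<forall>z'. z' - c \<in> range ((*v) N) \<longrightarrow> z \<bullet> (Q *v z) \<le> z' \<bullet> (Q *v z'))"
    then obtain v where v: "z = zs + N *v v" by (auto simp: feasible)
    have "z \<bullet> (Q *v z) \<le> zs \<bullet> (Q *v zs)"
      using z zs_feasible by blast
    then have "\<not> 0 < (N *v v) \<bullet> (Q *v (N *v v))" using expand[of v] v by simp
    with pos have "v = 0" by blast
    with v show "z = zs" by simp
  qed
qed

theorem theorem2:
  fixes Jxphi :: "real \<Rightarrow> real^'n^'k" and Jxf :: "real \<Rightarrow> real^'n^'n"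
    and Juphi :: "real \<Rightarrow> real^'m^'k" and Juf :: "real \<Rightarrow> real^'m^'n"
    and P :: "real \<Rightarrow> real^('k + 'n)^('k + 'n)"
    and cbar :: "real^'k" and Ns :: "real^'s^('k + 'n)"
    and tf T :: real
  defines "A \<equiv> Amat Jxphi Jxf" and "C \<equiv> Cmat Juphi Juf"
  assumes tf_pos: "0 < tf"
    and cont_A: "continuous_on {0..tf} A" and cont_C: "continuous_on {0..tf} C"
    and bnd_A: "bounded (A ` {0..tf})" and bnd_C: "bounded (C ` {0..tf})"
    and Qo_exists: "\<forall>j < CARD('k + 'n) - 1. \<forall>t \<in> {0..tf}.
                      obs_blk A C {0..tf} j differentiable (at t within {0..tf})"
    and bnd_Qo: "bounded (obs_mat A C {0..tf} ` {0..tf})"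
    and riccati: "\<forall>t \<in> {0..tf}. (P has_vector_derivative
                    (- (transpose (A t) ** P t) - P t ** A t - transpose (C t) ** C t
                     + P t ** Bmat ** transpose Bmat ** P t)) (at t within {0..tf})"
    and P_end: "P tf = 0"
    and Ns_inj: "\<forall>w. Ns *v w = 0 \<longrightarrow> w = 0"
    and Ns_ker: "range (\<lambda>w. Ns *v w) = {z. diag_mat (ext_zero cbar :: real^('k + 'n)) *v z = 0}"
    and T: "0 < T" "T \<le> tf"
    and Qp_full: "AE t in lborel. t \<in> {0..T} \<longrightarrow>
          rank (transpose Ns ** obs_mat A C {0..tf} t ** transpose (obs_mat A C {0..tf} t) ** Ns)
            = CARD('s)"
  shows "pos_def_mat (transpose Ns ** P 0 ** Ns)
       \<and> (\<exists>!z. ioc_feasible cbar z \<and>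
              (\<forall>z'. ioc_feasible cbar z' \<longrightarrow> z \<bullet> (P 0 *v z) \<le> z' \<bullet> (P 0 *v z')))"
proof -
  let ?I = "{0..tf}"
  have P': "(P has_vector_derivative riccati_rhs (A t) Bmat (C t) (P t)) (at t within ?I)"
    if "t \<in> ?I" for t
    using riccati that by (simp add: riccati_rhs_def)
  have P0_sym: "transpose (P 0) = P 0"
    using riccati_solution_symmetric[OF P' cont_A, of tf 0] tf_pos P_end
    by (simp add: transpose_zero)
  have pos: "0 < (Ns *v w) \<bullet> (P 0 *v (Ns *v w))" if "w \<noteq> 0" for w
  proof (rule riccati_value_pos_if_observable[OF T cont_A _ _ P' P_end Ns_ker Qp_full])
    show "(A t *v v) $ Inl i = 0" for t v i by (simp add: A_def Amat_mult_vec_Inl)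
    show "obs_blk A C ?I j differentiable (at t within ?I)"
      if "j < CARD('k + 'n) - 1" "t \<in> ?I" for j t
      using Qo_exists that by blast
    show "Ns *v w \<noteq> 0" using Ns_inj that by blast
  qed auto
  have feasible: "ioc_feasible cbar z \<longleftrightarrow> z - ext_zero cbar \<in> range ((*v) Ns)" for z
    using Ns_ker by (simp add: ioc_feasible_iff)
  show ?thesis
    unfolding feasible
    using pos_def_mat_congruence[OF P0_sym pos] quadratic_form_unique_min_on_affine[OF P0_sym pos]
    by blast
qed

end
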